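(* Let $N\ge 2$ and let $(S_i)_{i\in\mathbb{Z}_N}$ be a representation of $\mathcal{O}_N$ on a Hilbert space $\mathcal{H}$. Suppose that there is a cyclic vector $\varphi\in\mathcal{H}$ (for the representation) and some complex numbers $z_i$, $i\in\mathbb{Z}_N$, such that $S_i^*\varphi=z_i\varphi$ for all $i\in\mathbb{Z}_N$. Then the representation is monic.
   Context: Let $\mathbb{Z}_N=\{0,1,\dots,N-1\}$. A representation of $\mathcal{O}_N$ on a Hilbert space $\mathcal{H}$ is a family of isometries $(S_i)_{i\in\mathbb{Z}_N}$ with $S_i^*S_j=\delta_{ij}I$ and $\sum_{i}S_iS_i^*=I$. For a finite word $I=i_1\dots i_n$ with letters in $\mathbb{Z}_N$, $S_I:=S_{i_1}\cdots S_{i_n}$ ($S_\emptyset=I$). A vector $\varphi$ is cyclic for the representation if the closed linear span of $\{S_IS_J^*\varphi: I,J\text{ finite words}\}$ is $\mathcal{H}$. The representation is monic if there is a vector $\psi\in\mathcal{H}$ such that the closed linear span of $\{S_IS_I^*\psi : I \text{ a finite word}\}$ is $\mathcal{H}$. *)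

theory Defs
  imports "HOL-Analysis.Analysis"
begin

text \<open>
  A complex Hilbert space is a complete real inner product space that carries a compatible complex
  scalar multiplication and a sesquilinear form (conjugate-linear in the first argument) whose real
  part is the given real inner product. Hence norm and topology are those induced by the form;
  see \<open>cinner_self\<close> below.
\<close>

class complex_hilbert_space = real_inner + complete_space +
  fixes scaleC :: "complex \<Rightarrow> 'a \<Rightarrow> 'a"  (infixr \<open>*\<^sub>C\<close> 75)
    and cinner :: "'a \<Rightarrow> 'a \<Rightarrow> complex"
  assumes scaleC_add_right: "a *\<^sub>C (x + y) = a *\<^sub>C x + a *\<^sub>C y"
    and scaleC_add_left: "(a + b) *\<^sub>C x = a *\<^sub>C x + b *\<^sub>C x"
    and scaleC_scaleC: "a *\<^sub>C b *\<^sub>C x = (a * b) *\<^sub>C x"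
    and scaleC_of_real: "complex_of_real r *\<^sub>C x = scaleR r x"
    and cinner_commute: "cinner x y = cnj (cinner y x)"
    and cinner_add_right: "cinner x (y + z) = cinner x y + cinner x z"
    and cinner_scaleC_right: "cinner x (a *\<^sub>C y) = a * cinner x y"
    and Re_cinner: "Re (cinner x y) = inner x y"
begin

subclass banach ..

end

lemma scaleC_one: "1 *\<^sub>C x = (x :: 'a :: complex_hilbert_space)"
  using scaleC_of_real[of 1 x] by simp

lemma cinner_self: "cinner x x = complex_of_real ((norm x)\<^sup>2)"
  for x :: "'a :: complex_hilbert_space"
proof (rule complex_eqI)
  show "Re (cinner x x) = Re (complex_of_real ((norm x)\<^sup>2))"
    by (simp add: Re_cinner power2_norm_eq_inner)
  have "Im (cinner x x) = - Im (cinner x x)"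
    by (subst cinner_commute) simp
  then show "Im (cinner x x) = Im (complex_of_real ((norm x)\<^sup>2))"
    by simp
qed

global_interpretation complex_vector: vector_space "scaleC :: complex \<Rightarrow> 'a \<Rightarrow> 'a :: complex_hilbert_space"
  by unfold_locales (simp_all add: scaleC_add_right scaleC_add_left scaleC_scaleC scaleC_one)

definition closed_cspan :: "'a :: complex_hilbert_space set \<Rightarrow> 'a set" where
  "closed_cspan A = closure (complex_vector.span A)"

definition isometry :: "('a :: complex_hilbert_space \<Rightarrow> 'a) \<Rightarrow> bool" where
  "isometry T \<longleftrightarrow> Vector_Spaces.linear scaleC scaleC T \<and> (\<forall>x. norm (T x) = norm x)"

text \<open>
  The Hilbert space adjoint, in the style of \<^const>\<open>adjoint\<close>. It is always unique, and it exists
  for every bounded linear operator; it is only applied to compositions of isometries.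
\<close>

definition cadjoint :: "('a :: complex_hilbert_space \<Rightarrow> 'a) \<Rightarrow> 'a \<Rightarrow> 'a" where
  "cadjoint T = (SOME T'. \<forall>x y. cinner (T x) y = cinner x (T' y))"

text \<open>The index set is \<open>{..<N}\<close>; values of \<open>S\<close> outside of it are irrelevant.\<close>

definition cuntz_representation :: "nat \<Rightarrow> (nat \<Rightarrow> 'a :: complex_hilbert_space \<Rightarrow> 'a) \<Rightarrow> bool" where
  "cuntz_representation N S \<longleftrightarrow>
     (\<forall>i<N. isometry (S i)) \<and>
     (\<forall>i<N. \<forall>j<N. cadjoint (S i) \<circ> S j = (if i = j then id else (\<lambda>x. 0))) \<and>
     (\<lambda>x. \<Sum>i<N. S i (cadjoint (S i) x)) = id"

definition words :: "nat \<Rightarrow> nat list set" where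
  "words N = lists {..<N}"

fun word_op :: "(nat \<Rightarrow> 'a \<Rightarrow> 'a) \<Rightarrow> nat list \<Rightarrow> 'a \<Rightarrow> 'a" where
  "word_op S [] = id"
| "word_op S (i # I) = S i \<circ> word_op S I"

definition cyclic_vector :: "nat \<Rightarrow> (nat \<Rightarrow> 'a :: complex_hilbert_space \<Rightarrow> 'a) \<Rightarrow> 'a \<Rightarrow> bool" where
  "cyclic_vector N S \<phi> \<longleftrightarrow>
     closed_cspan {word_op S I (cadjoint (word_op S J) \<phi>) | I J. I \<in> words N \<and> J \<in> words N} = UNIV"

definition monic :: "nat \<Rightarrow> (nat \<Rightarrow> 'a :: complex_hilbert_space \<Rightarrow> 'a) \<Rightarrow> bool" where
  "monic N S \<longleftrightarrow>
     (\<exists>\<psi>. closed_cspan {word_op S I (cadjoint (word_op S I) \<psi>) | I. I \<in> words N} = UNIV)"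

end

theory Submission
  imports Defs
begin

text \<open>
  If no \<open>z i\<close> vanished, \<open>\<phi>\<close> itself would be a monic vector, because \<open>S\<^sub>I S\<^sub>I\<^sup>* \<phi>\<close> is a multiple
  of \<open>S\<^sub>I \<phi>\<close> by a product of the \<open>z i\<close>. In general put \<open>\<psi> = \<phi> + \<xi>\<close>, where \<open>\<xi>\<close> solves
  \<open>\<xi> = (\<Sum>i | z i = 0. S i \<phi>) + t (\<Sum>i. S i \<xi>)\<close> with \<open>t = 1 / (2 N)\<close>. The span of \<open>\<phi>\<close> and \<open>\<xi>\<close>
  is invariant under all \<open>S\<^sub>i\<^sup>*\<close>, and \<open>S\<^sub>I\<^sup>* \<psi> = a \<phi> + t\<^bsup>|I|\<^esup> \<xi>\<close> with \<open>a \<noteq> 0\<close>. Since \<open>\<phi>\<close> is the sum of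
  \<open>z i S i \<phi>\<close> over the \<open>i\<close> with \<open>z i \<noteq> 0\<close>, the vector \<open>a S\<^sub>I \<phi>\<close> can be expanded along words
  with such letters; the number of words of length \<open>n\<close> grows like \<open>N\<^sup>n\<close> while the error
  decays like \<open>t\<^sup>n\<close>, so \<open>S\<^sub>I \<phi>\<close> is a limit of combinations of the \<open>S\<^sub>K S\<^sub>K\<^sup>* \<psi>\<close>.
\<close>

section \<open>Complex scalars and the inner product\<close>

lemma cinner_scaleC_left: "cinner (a *\<^sub>C x) y = cnj a * cinner x y"
  by (metis cinner_commute cinner_scaleC_right complex_cnj_mult)

lemma cinner_zero_right [simp]: "cinner x 0 = 0"
  using cinner_add_right[of x 0 0] by simp

lemma cinner_sum_right: "cinner x (sum f A) = (\<Sum>i\<in>A. cinner x (f i))"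
  by (induction A rule: infinite_finite_induct) (auto simp: cinner_add_right)

lemma cinner_ext:
  assumes "\<And>u. cinner u x = cinner u y"
  shows "x = y"
proof -
  have "inner u x = inner u y" for u
    using assms[of u] by (metis Re_cinner)
  then show ?thesis
    using vector_eq_ldot[of x y] by blast
qed

lemma norm_scaleC: "norm (a *\<^sub>C x) = cmod a * norm x"
proof -
  have "complex_of_real ((norm (a *\<^sub>C x))\<^sup>2) = (a * cnj a) * complex_of_real ((norm x)\<^sup>2)"
    unfolding cinner_self[symmetric]
    by (simp add: cinner_scaleC_left cinner_scaleC_right mult_ac)
  also have "\<dots> = complex_of_real ((cmod a * norm x)\<^sup>2)"
    by (simp add: complex_norm_square[symmetric] power_mult_distrib)
  finally have "(norm (a *\<^sub>C x))\<^sup>2 = (cmod a * norm x)\<^sup>2"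
    using of_real_eq_iff by blast
  then show ?thesis
    by (simp add: power2_eq_iff_nonneg)
qed

lemma bounded_linear_scaleC: "bounded_linear ((*\<^sub>C) a)"
proof (rule bounded_linear_intro)
  show "a *\<^sub>C r *\<^sub>R x = r *\<^sub>R a *\<^sub>C x" for r x
    by (simp add: scaleC_of_real[symmetric] scaleC_scaleC mult.commute)
  show "norm (a *\<^sub>C x) \<le> norm x * cmod a" for x
    by (simp add: norm_scaleC)
qed (rule scaleC_add_right)

section \<open>Closed complex spans\<close>

lemma subspace_closed_cspan: "complex_vector.subspace (closed_cspan A)"
proof (rule complex_vector.subspaceI)
  show "0 \<in> closed_cspan A"
    unfolding closed_cspan_def using closure_subset complex_vector.span_zero by blast
next
  fix x y
  assume "x \<in> closed_cspan A" "y \<in> closed_cspan A"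
  then obtain f g where "\<And>n. f n \<in> complex_vector.span A" "f \<longlonglongrightarrow> x"
    "\<And>n. g n \<in> complex_vector.span A" "g \<longlonglongrightarrow> y"
    unfolding closed_cspan_def closure_sequential by blast
  then have "\<forall>n. f n + g n \<in> complex_vector.span A" "(\<lambda>n. f n + g n) \<longlonglongrightarrow> x + y"
    by (auto intro: tendsto_add complex_vector.span_add)
  then show "x + y \<in> closed_cspan A"
    unfolding closed_cspan_def closure_sequential by (intro exI[of _ "\<lambda>n. f n + g n"]) simp
next
  fix a x
  assume "x \<in> closed_cspan A"
  moreover have "(*\<^sub>C) a ` closure (complex_vector.span A) \<subseteq> closure (complex_vector.span A)"
    by (rule image_closure_subset)
      (auto intro: linear_continuous_on bounded_linear_scaleC complex_vector.span_scale
        subsetD[OF closure_subset])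
  ultimately show "a *\<^sub>C x \<in> closed_cspan A"
    unfolding closed_cspan_def by blast
qed

lemma closed_cspan_minimal:
  assumes "A \<subseteq> closed_cspan B"
  shows "closed_cspan A \<subseteq> closed_cspan B"
  using complex_vector.span_minimal[OF assms subspace_closed_cspan]
  unfolding closed_cspan_def by (simp add: closure_minimal)

section \<open>Isometries\<close>

lemma isometry_comp: "isometry T \<Longrightarrow> isometry U \<Longrightarrow> isometry (T \<circ> U)"
  by (auto simp: isometry_def intro: Vector_Spaces.linear_compose)

lemma isometry_id: "isometry id"
  by (simp add: isometry_def complex_vector.linear_id)

lemma isometry_add: "isometry T \<Longrightarrow> T (x + y) = T x + T y"
  by (auto simp: isometry_def linear_iff_module_hom intro: module_hom.add)

lemma isometry_scaleC: "isometry T \<Longrightarrow> T (a *\<^sub>C x) = a *\<^sub>C T x"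
  by (auto simp: isometry_def linear_iff_module_hom intro: module_hom.scale)

lemma isometry_diff: "isometry T \<Longrightarrow> T (x - y) = T x - T y"
  by (auto simp: isometry_def linear_iff_module_hom intro: module_hom.diff)

lemma isometry_sum: "isometry T \<Longrightarrow> T (sum f A) = (\<Sum>i\<in>A. T (f i))"
  by (auto simp: isometry_def linear_iff_module_hom intro: module_hom.sum)

text \<open>Polarisation recovers the real inner product from norms. The imaginary part is a real
  inner product with \<open>(- \<i>) *\<^sub>C v\<close>, and \<open>T\<close> commutes with that
  scalar.\<close>

lemma isometry_cinner:
  assumes "isometry T"
  shows "cinner (T x) (T y) = cinner x y"
proof -
  have *: "inner (T u) (T v) = inner u v" for u v
  proof -
    have "norm (T u + T v) = norm (u + v)" "norm (T u) = norm u" "norm (T v) = norm v"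
      using assms by (simp_all add: isometry_add[OF assms, symmetric] isometry_def)
    then show ?thesis
      by (simp add: dot_norm)
  qed
  have "Re (cinner (T x) (T y)) = Re (cinner x y)"
    by (simp add: Re_cinner *)
  moreover have Im: "Im (cinner u v) = inner u ((- \<i>) *\<^sub>C v)" for u v :: 'a
    by (simp only: Re_cinner[symmetric] cinner_scaleC_right) simp
  have "Im (cinner (T x) (T y)) = Im (cinner x y)"
    by (simp only: Im isometry_scaleC[OF assms, symmetric] *)
  ultimately show ?thesis
    by (rule complex_eqI)
qed

section \<open>Adjoints: uniqueness, linearity and existence\<close>

lemma cadjointI:
  assumes "\<And>x y. cinner (T x) y = cinner x (T' y)"
  shows "cadjoint T = T'"
proof -
  have "\<forall>x y. cinner (T x) y = cinner x (cadjoint T y)"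
    unfolding cadjoint_def by (rule someI[of _ T']) (use assms in blast)
  then show ?thesis
    by (intro ext cinner_ext) (simp add: assms[symmetric])
qed

lemma
  assumes "\<And>x y. cinner (T x) y = cinner x (T' y)"
  shows adjoint_add: "T' (x + y) = T' x + T' y"
    and adjoint_scaleC: "T' (a *\<^sub>C x) = a *\<^sub>C T' x"
  by (rule cinner_ext, simp add: assms[symmetric] cinner_add_right cinner_scaleC_right)+

text \<open>
  Existence of the adjoint is not immediate because \<^const>\<open>cadjoint\<close> is a choice. If two of the
  generators had no adjoint, their \<^const>\<open>cadjoint\<close>s would be the same function, which the relations
  allow only on the zero space. If all generators but \<open>S i\<close> have an adjoint, then their ranges
  are orthogonal to that of \<open>S i\<close>, and \<open>\<Sum>i<N. S i (cadjoint (S i) x) = x\<close> shows that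
  \<open>cadjoint (S i)\<close> is an adjoint as well.
\<close>

lemma cuntz_cadjoint:
  assumes rep: "cuntz_representation N S" and i: "i < N"
  shows "cinner (S i x) y = cinner x (cadjoint (S i) y)"
proof (rule ccontr)
  assume neg: "cinner (S i x) y \<noteq> cinner x (cadjoint (S i) y)"
  have iso: "isometry (S j)" if "j < N" for j
    using rep that by (simp add: cuntz_representation_def)
  have ortho: "cadjoint (S j) (S k u) = (if j = k then u else 0)" if "j < N" "k < N" for j k u
    using rep that unfolding cuntz_representation_def
    by (metis (full_types) comp_apply id_apply)
  have decomp: "(\<Sum>j<N. S j (cadjoint (S j) u)) = u" for u
    using rep unfolding cuntz_representation_def by (metis id_apply)
  have choice: "\<forall>u v. cinner (T u) v = cinner u (cadjoint T v)"
    if "\<exists>T'. \<forall>u v. cinner (T u) v = cinner u (T' v)" for T :: "'a \<Rightarrow> 'a"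
    using someI_ex[OF that] unfolding cadjoint_def .
  have no_adj: "(\<lambda>T'. \<forall>u v. cinner (S i u) v = cinner u (T' v)) = (\<lambda>_. False)"
    unfolding fun_eq_iff using choice[of "S i"] neg by blast
  have adj: "cinner (S j u) v = cinner u (cadjoint (S j) v)" if j: "j < N" "j \<noteq> i" for j u v
  proof (rule ccontr)
    assume "cinner (S j u) v \<noteq> cinner u (cadjoint (S j) v)"
    then have "(\<lambda>T'. \<forall>u v. cinner (S j u) v = cinner u (T' v)) = (\<lambda>_. False)"
      unfolding fun_eq_iff using choice[of "S j"] by blast
    then have "cadjoint (S j) = cadjoint (S i)"
      unfolding cadjoint_def no_adj by simp
    then have "w = 0" for w :: 'a
      using ortho[OF i i, of w] ortho[OF j(1) i, of w] j(2) by simp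
    then have "y = 0" "cadjoint (S i) y = 0"
      by blast+
    then show False
      using neg by simp
  qed
  have "cinner (S i x) (S j (cadjoint (S j) y)) = (if j = i then cinner x (cadjoint (S i) y) else 0)"
    if j: "j < N" for j
  proof (cases "j = i")
    case False
    then have "cinner (S j (cadjoint (S j) y)) (S i x) = 0"
      using j i by (simp add: adj ortho)
    then show ?thesis
      using False by (metis cinner_commute complex_cnj_zero)
  qed (simp add: iso i isometry_cinner)
  then have "cinner (S i x) (\<Sum>j<N. S j (cadjoint (S j) y)) = cinner x (cadjoint (S i) y)"
    using i by (simp add: cinner_sum_right)
  then show False
    using neg by (simp add: decomp)
qed

section \<open>Words and their operators\<close>

lemma words_Nil [simp]: "[] \<in> words N"
  and words_snoc [simp]: "I @ [i] \<in> words N \<longleftrightarrow> I \<in> words N \<and> i < N"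
  and words_Cons [simp]: "i # I \<in> words N \<longleftrightarrow> i < N \<and> I \<in> words N"
  by (auto simp: words_def)

lemma word_op_snoc: "word_op S (I @ [i]) = word_op S I \<circ> S i"
  by (induction I) (auto simp: comp_assoc)

lemma isometry_word_op:
  assumes "cuntz_representation N S" "I \<in> words N"
  shows "isometry (word_op S I)"
  using assms(2)
proof (induction I)
  case (Cons i I)
  then have "isometry (S i)" "isometry (word_op S I)"
    using assms(1) by (simp_all add: cuntz_representation_def)
  then show ?case
    unfolding word_op.simps by (rule isometry_comp)
qed (simp add: isometry_id)

lemma cadjoint_word_op_Nil: "cadjoint (word_op S []) x = x"
proof -
  have "cadjoint (word_op S []) = id"
    by (rule cadjointI) simp
  then show ?thesis
    by simp
qed

text \<open>As \<open>cadjoint\<close> is a choice, an adjoint must first be exhibited: the letter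
  adjoints composed in reverse order are one, and \<open>cadjointI\<close> identifies the choice
  with it.\<close>

lemma word_op_cadjoint:
  assumes rep: "cuntz_representation N S" and "I \<in> words N"
  shows "cinner (word_op S I x) y = cinner x (cadjoint (word_op S I) y)"
  using assms(2)
proof (induction I arbitrary: x y)
  case Nil
  show ?case
    by (simp only: cadjoint_word_op_Nil) simp
next
  case (Cons i I)
  have adj: "cinner (word_op S (i # I) x) y = cinner x (cadjoint (word_op S I) (cadjoint (S i) y))" for x y
  proof -
    have "cinner (word_op S (i # I) x) y = cinner (S i (word_op S I x)) y"
      by simp
    also have "\<dots> = cinner (word_op S I x) (cadjoint (S i) y)"
      using Cons.prems by (intro cuntz_cadjoint[OF rep]) simp
    also have "\<dots> = cinner x (cadjoint (word_op S I) (cadjoint (S i) y))"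
      using Cons.prems by (intro Cons.IH) simp
    finally show ?thesis .
  qed
  then have "cadjoint (word_op S (i # I)) = cadjoint (word_op S I) \<circ> cadjoint (S i)"
    by (intro cadjointI) (simp only: comp_apply)
  then show ?case
    by (simp only: adj comp_apply)
qed

text \<open>The adjoint of an appended letter acts last, so \<open>rev_induct\<close> can follow the
  image of a vector letter by letter.\<close>

lemma cadjoint_word_op_snoc:
  assumes "cuntz_representation N S" "I \<in> words N" "i < N"
  shows "cadjoint (word_op S (I @ [i])) x = cadjoint (S i) (cadjoint (word_op S I) x)"
proof -
  have "cadjoint (word_op S (I @ [i])) = cadjoint (S i) \<circ> cadjoint (word_op S I)"
    using assms
    by (intro cadjointI) (simp add: word_op_snoc word_op_cadjoint cuntz_cadjoint)
  then show ?thesis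
    by simp
qed

theorem corollary3p12:
  fixes N :: nat
    and S :: "nat \<Rightarrow> 'a :: complex_hilbert_space \<Rightarrow> 'a"
    and \<phi> :: 'a
    and z :: "nat \<Rightarrow> complex"
  assumes "N \<ge> 2"
    and "cuntz_representation N S"
    and "cyclic_vector N S \<phi>"
    and "\<And>i. i < N \<Longrightarrow> cadjoint (S i) \<phi> = z i *\<^sub>C \<phi>"
  shows "monic N S"
proof -
  note rep = assms(2)
  note adj = cuntz_cadjoint[OF rep]
  have iso: "isometry (S i)" if "i < N" for i
    using rep that by (simp add: cuntz_representation_def)
  have ortho: "cadjoint (S i) (S j u) = (if i = j then u else 0)" if "i < N" "j < N" for i j u
    using rep that unfolding cuntz_representation_def
    by (metis (full_types) comp_apply id_apply)
  have decomp: "(\<Sum>i<N. S i (cadjoint (S i) u)) = u" for u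
    using rep unfolding cuntz_representation_def by (metis id_apply)
  have adj_add: "cadjoint (S i) (x + y) = cadjoint (S i) x + cadjoint (S i) y"
    and adj_scale: "cadjoint (S i) (a *\<^sub>C x) = a *\<^sub>C cadjoint (S i) x" if "i < N" for i a x y
    using adjoint_add[of "S i", OF adj] adjoint_scaleC[of "S i", OF adj] that by blast+
  \<comment> \<open>Later applied to both sums in the equation for \<xi>: with varying coefficients
    on \<open>S i \<phi>\<close> and with a constant one on \<open>S i \<xi>\<close>.\<close>
  have adj_sum: "cadjoint (S i) (\<Sum>j<N. f j *\<^sub>C S j u) = f i *\<^sub>C u" if i: "i < N" for i f u
  proof -
    have "cinner v (cadjoint (S i) (\<Sum>j<N. f j *\<^sub>C S j u)) = cinner v (f i *\<^sub>C u)" for v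
    proof -
      have "cinner v (cadjoint (S i) (\<Sum>j<N. f j *\<^sub>C S j u)) =
          (\<Sum>j<N. f j * cinner v (cadjoint (S i) (S j u)))"
        using i by (simp add: adj[symmetric] cinner_sum_right cinner_scaleC_right)
      also have "\<dots> = (\<Sum>j<N. if j = i then f i * cinner v u else 0)"
        using i by (intro sum.cong) (auto simp: ortho)
      finally show ?thesis
        using i by (simp add: cinner_scaleC_right)
    qed
    then show ?thesis
      by (rule cinner_ext)
  qed

  \<comment> \<open>The value \<open>N * t = 1 / 2\<close> serves twice: it makes the map below a
    contraction, and it outweighs the \<open>N\<close> branches at each level of
    \<open>approx\<close>. Positivity keeps the powers of \<open>c\<close> nonzero.\<close>
  define t :: real where "t = 1 / (2 * real N)"
  have t: "t > 0" and Nt: "real N * t = 1 / 2"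
    using assms(1) by (auto simp: t_def)
  define c where "c = complex_of_real t"
  have c: "c \<noteq> 0" "cmod c = t"
    using t by (auto simp: c_def)
  define u :: "nat \<Rightarrow> complex" where "u i = (if z i = 0 then 1 else 0)" for i

  have "\<exists>!\<xi>. (\<Sum>i<N. u i *\<^sub>C S i \<phi>) + (\<Sum>i<N. c *\<^sub>C S i \<xi>) = \<xi>"
  proof (rule banach_fix_type[of "1/2"], safe)
    fix x y
    have "dist ((\<Sum>i<N. u i *\<^sub>C S i \<phi>) + (\<Sum>i<N. c *\<^sub>C S i x))
        ((\<Sum>i<N. u i *\<^sub>C S i \<phi>) + (\<Sum>i<N. c *\<^sub>C S i y)) = norm (\<Sum>i<N. c *\<^sub>C S i (x - y))"
      by (simp add: dist_norm sum_subtractf[symmetric] iso isometry_diff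
          complex_vector.scale_right_diff_distrib)
    also have "\<dots> \<le> (\<Sum>i<N. t * norm (x - y))"
      using iso by (intro sum_norm_le) (simp add: norm_scaleC c isometry_def)
    also have "\<dots> = 1 / 2 * dist x y"
      using Nt by (simp add: dist_norm)
    finally show "dist ((\<Sum>i<N. u i *\<^sub>C S i \<phi>) + (\<Sum>i<N. c *\<^sub>C S i x))
        ((\<Sum>i<N. u i *\<^sub>C S i \<phi>) + (\<Sum>i<N. c *\<^sub>C S i y)) \<le> 1 / 2 * dist x y" .
  qed auto
  then obtain \<xi> where \<xi>: "\<xi> = (\<Sum>i<N. u i *\<^sub>C S i \<phi>) + (\<Sum>i<N. c *\<^sub>C S i \<xi>)"
    by metis
  have adj_\<xi>: "cadjoint (S i) \<xi> = u i *\<^sub>C \<phi> + c *\<^sub>C \<xi>" if "i < N" for i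
    using that by (subst \<xi>) (simp add: adj_add adj_sum)
  define \<psi> where "\<psi> = \<phi> + \<xi>"
  let ?A = "{word_op S I (cadjoint (word_op S I) \<psi>) | I. I \<in> words N}"

  have coeff_snoc: "cadjoint (word_op S (I @ [i])) \<psi> = (a * z i + c ^ length I * u i) *\<^sub>C \<phi> + c ^ length (I @ [i]) *\<^sub>C \<xi>"
    if "I \<in> words N" "cadjoint (word_op S I) \<psi> = a *\<^sub>C \<phi> + c ^ length I *\<^sub>C \<xi>" "i < N" for I a i
    using that
    by (simp add: cadjoint_word_op_snoc[OF rep] adj_add adj_scale assms(4) adj_\<xi> scaleC_scaleC
        scaleC_add_left scaleC_add_right mult.commute)

  have coeff: "\<exists>a. a \<noteq> 0 \<and> cadjoint (word_op S I) \<psi> = a *\<^sub>C \<phi> + c ^ length I *\<^sub>C \<xi>"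
    if "I \<in> words N" for I
    using that
  proof (induction I rule: rev_induct)
    case Nil
    have "cadjoint (word_op S []) \<psi> = 1 *\<^sub>C \<phi> + c ^ length [] *\<^sub>C \<xi>"
      by (simp only: cadjoint_word_op_Nil) (simp add: \<psi>_def scaleC_one)
    then show ?case
      by (metis zero_neq_one)
  next
    case (snoc i I)
    then obtain a where "a \<noteq> 0" "cadjoint (word_op S I) \<psi> = a *\<^sub>C \<phi> + c ^ length I *\<^sub>C \<xi>"
      by auto
    \<comment> \<open>Exactly one summand survives: \<open>a * z i\<close> if
      \<open>z i \<noteq> 0\<close>, and \<open>c ^ length I\<close> otherwise.\<close>
    moreover have "a * z i + c ^ length I * u i \<noteq> 0" if "a \<noteq> 0"
      using that c by (simp add: u_def)
    ultimately show ?case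
      using coeff_snoc snoc.prems by (metis words_snoc)
  qed

  \<comment> \<open>Here \<open>n\<close> is the depth to which \<open>word_op S I \<phi>\<close> is
    expanded along further letters; each level passes to \<open>I @ [i]\<close> with coefficient
    \<open>a * z i\<close>.\<close>
  have approx: "\<exists>m \<in> complex_vector.span ?A. norm (a *\<^sub>C word_op S I \<phi> - m) \<le> (1 / 2) ^ n * t ^ length I * norm \<xi>"
    if "I \<in> words N" "cadjoint (word_op S I) \<psi> = a *\<^sub>C \<phi> + c ^ length I *\<^sub>C \<xi>" for n I a
    using that
  proof (induction n arbitrary: I a)
    case 0
    note isoI = isometry_word_op[OF rep 0(1)]
    \<comment> \<open>At depth 0, the projection of \<psi> onto the range of
      \<open>word_op S I\<close> is off by its \<xi> term only.\<close>
    have "a *\<^sub>C word_op S I \<phi> - word_op S I (cadjoint (word_op S I) \<psi>) = - (c ^ length I *\<^sub>C word_op S I \<xi>)"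
      by (simp add: 0 isometry_add[OF isoI] isometry_scaleC[OF isoI])
    then have "norm (a *\<^sub>C word_op S I \<phi> - word_op S I (cadjoint (word_op S I) \<psi>)) = t ^ length I * norm \<xi>"
      using isoI by (simp add: norm_scaleC c norm_power isometry_def)
    moreover have "word_op S I (cadjoint (word_op S I) \<psi>) \<in> complex_vector.span ?A"
      using 0(1) by (blast intro: complex_vector.span_base)
    ultimately show ?case
      by (intro bexI) auto
  next
    case (Suc n)
    note isoI = isometry_word_op[OF rep Suc.prems(1)]
    let ?e = "(1 / 2) ^ n * t ^ Suc (length I) * norm \<xi>"
    have "\<exists>m \<in> complex_vector.span ?A. norm ((a * z i) *\<^sub>C word_op S (I @ [i]) \<phi> - m) \<le> ?e"
      if i: "i < N" for i
    \<comment> \<open>If \<open>z i = 0\<close>, the term is zero and so is its approximant; the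
      induction hypothesis would not fit, as the coefficient at \<open>I @ [i]\<close> is
      \<open>c ^ length I\<close>. Otherwise \<open>u i = 0\<close> and that coefficient is exactly
      \<open>a * z i\<close>.\<close>
    proof (cases "z i = 0")
      case True
      then show ?thesis
        using t by (intro bexI[of _ 0]) (auto simp: complex_vector.span_zero)
    next
      case False
      then show ?thesis
        using Suc.IH[of "I @ [i]" "a * z i"] coeff_snoc[OF Suc.prems i] Suc.prems(1) i
        by (simp add: u_def)
    qed
    then have "\<forall>i\<in>{..<N}. \<exists>m. m \<in> complex_vector.span ?A \<and>
        norm ((a * z i) *\<^sub>C word_op S (I @ [i]) \<phi> - m) \<le> ?e"
      by blast
    from bchoice[OF this] obtain m where m: "\<And>i. i < N \<Longrightarrow> m i \<in> complex_vector.span ?A"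
      "\<And>i. i < N \<Longrightarrow> norm ((a * z i) *\<^sub>C word_op S (I @ [i]) \<phi> - m i) \<le> ?e"
      by blast
    \<comment> \<open>The next level of the expansion comes from \<open>decomp\<close> at the joint
      eigenvector \<phi>.\<close>
    have "word_op S I \<phi> = word_op S I (\<Sum>i<N. z i *\<^sub>C S i \<phi>)"
      using decomp[of \<phi>] assms(4) iso by (simp add: isometry_scaleC)
    then have "a *\<^sub>C word_op S I \<phi> = (\<Sum>i<N. (a * z i) *\<^sub>C word_op S (I @ [i]) \<phi>)"
      by (simp add: isometry_sum[OF isoI] isometry_scaleC[OF isoI] word_op_snoc
          complex_vector.scale_sum_right scaleC_scaleC)
    then have "norm (a *\<^sub>C word_op S I \<phi> - (\<Sum>i<N. m i)) \<le> (\<Sum>i<N. ?e)"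
      using m(2) by (simp only: sum_subtractf[symmetric]) (rule sum_norm_le, simp)
    \<comment> \<open>Each longer word gains a factor \<open>t\<close> and there are
      \<open>N\<close> of them, so the error bound is halved.\<close>
    also have "\<dots> = (real N * t) * ((1 / 2) ^ n * t ^ length I * norm \<xi>)"
      by simp
    also have "\<dots> = (1 / 2) ^ Suc n * t ^ length I * norm \<xi>"
      unfolding Nt by simp
    finally show ?case
      using m(1) by (intro bexI[of _ "\<Sum>i<N. m i"]) (auto intro: complex_vector.span_sum)
  qed

  have word_in: "word_op S I \<phi> \<in> closed_cspan ?A" if I: "I \<in> words N" for I
  proof -
    obtain a where a: "a \<noteq> 0" "cadjoint (word_op S I) \<psi> = a *\<^sub>C \<phi> + c ^ length I *\<^sub>C \<xi>"
      using coeff[OF I] by blast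
    have "a *\<^sub>C word_op S I \<phi> \<in> closed_cspan ?A"
      unfolding closed_cspan_def closure_approachable
    proof (intro allI impI)
      fix e :: real
      assume "e > 0"
      have "(\<lambda>n. (1 / 2) ^ n * (t ^ length I * norm \<xi>)) \<longlonglongrightarrow> 0"
        by (intro tendsto_mult_left_zero LIMSEQ_power_zero) simp
      then obtain n where "(1 / 2) ^ n * (t ^ length I * norm \<xi>) < e"
        using order_tendstoD(2)[OF _ \<open>e > 0\<close>] eventually_sequentially by (metis order_refl)
      moreover obtain m where "m \<in> complex_vector.span ?A"
        "norm (a *\<^sub>C word_op S I \<phi> - m) \<le> (1 / 2) ^ n * t ^ length I * norm \<xi>"
        using approx[OF I a(2)] by blast
      ultimately show "\<exists>m \<in> complex_vector.span ?A. dist m (a *\<^sub>C word_op S I \<phi>) < e"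
        by (intro bexI[of _ m]) (auto simp: dist_norm norm_minus_commute mult.assoc)
    qed
    \<comment> \<open>While \<open>approx\<close> allows any \<open>a\<close>,
      \<open>a \<noteq> 0\<close> is what recovers \<open>word_op S I \<phi>\<close> itself.\<close>
    then have "inverse a *\<^sub>C a *\<^sub>C word_op S I \<phi> \<in> closed_cspan ?A"
      by (rule complex_vector.subspace_scale[OF subspace_closed_cspan])
    then show ?thesis
      using a(1) by (simp add: scaleC_scaleC scaleC_one)
  qed

  \<comment> \<open>The words \<open>J\<close> in the cyclicity condition thus contribute only
    scalars, which reduces it to the vectors of \<open>word_in\<close>.\<close>
  have eigen: "\<exists>b. cadjoint (word_op S J) \<phi> = b *\<^sub>C \<phi>" if "J \<in> words N" for J
    using that
  proof (induction J rule: rev_induct)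
    case Nil
    show ?case
      by (metis cadjoint_word_op_Nil scaleC_one)
  next
    case (snoc j J)
    then show ?case
      by (auto simp: cadjoint_word_op_snoc[OF rep] adj_scale assms(4) scaleC_scaleC)
  qed
  have "word_op S I (cadjoint (word_op S J) \<phi>) \<in> closed_cspan ?A"
    if I: "I \<in> words N" and J: "J \<in> words N" for I J
  proof -
    obtain b where "cadjoint (word_op S J) \<phi> = b *\<^sub>C \<phi>"
      using eigen[OF J] by blast
    then show ?thesis
      using word_in[OF I] complex_vector.subspace_scale[OF subspace_closed_cspan]
      by (simp add: isometry_scaleC isometry_word_op[OF rep I])
  qed
  then have "closed_cspan {word_op S I (cadjoint (word_op S J) \<phi>) | I J. I \<in> words N \<and> J \<in> words N}
      \<subseteq> closed_cspan ?A"
    by (intro closed_cspan_minimal) blast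
  then have "closed_cspan ?A = UNIV"
    using assms(3) by (simp add: cyclic_vector_def top.extremum_unique)
  then show ?thesis
    unfolding monic_def by blast
qed

end
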